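(* Consider the restricted assignment problem: $m$ machines and $n$ jobs, where each job $j$ has a size $p_j>0$ and for each machine $i$, $p_{ij}\in\{p_j,\infty\}$; the goal is to find an assignment of jobs to machines with $p_{ij}<\infty$ minimizing the makespan. Let $\mathcal{I}$ be such an instance with feasibility factor $h\in(0,1]$, and let $p_{\max}=\max_j p_j$. If there exists $q$ with $0<q<h$ such that $\frac{1}{m}\sum_{j=1}^n p_j=q\cdot p_{\max}$, then there exists a $\left(1+\frac{q}{h}\right)$-approximation algorithm for the minimum makespan of $\mathcal{I}$ whose running time is $O(m^2n)$.
   Context: The load of machine $i$ under an assignment $\alpha$ is the sum of $p_j$ over jobs $j$ assigned to $i$; the makespan is the maximum load. The feasibility factor of $\mathcal{I}$ is $h=\frac1m\min_j|\{i:p_{ij}<\infty\}|$. A $\rho$-approximation algorithm outputs a feasible assignment whose makespan is at most $\rho$ times the optimal makespan. *)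

theory Defs
  imports "HOL-Library.FuncSet" "HOL-Library.Extended_Real"
begin

section \<open>Restricted assignment\<close>

text \<open>Machines are the indices below \<open>machines I\<close>, jobs the indices below \<open>jobs I\<close>;
  values at other indices are irrelevant. \<open>ptime I i j\<close> is $p_{ij}$ and
  \<open>psize I j\<close> is $p_j$.\<close>

record ra_instance =
  machines :: nat
  jobs :: nat
  psize :: "nat \<Rightarrow> real"
  ptime :: "nat \<Rightarrow> nat \<Rightarrow> ereal"

definition restricted_assignment :: "ra_instance \<Rightarrow> bool" where
  "restricted_assignment I \<longleftrightarrow>
     machines I \<ge> 1 \<and> jobs I \<ge> 1 \<and>
     (\<forall>j<jobs I. psize I j > 0) \<and>
     (\<forall>i<machines I. \<forall>j<jobs I. ptime I i j \<in> {ereal (psize I j), \<infinity>})"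

definition feasibility_factor :: "ra_instance \<Rightarrow> real" where
  "feasibility_factor I =
     1 / real (machines I) *
     real (Min ((\<lambda>j. card {i. i < machines I \<and> ptime I i j < \<infinity>}) ` {..<jobs I}))"

definition pmax :: "ra_instance \<Rightarrow> real" where
  "pmax I = Max (psize I ` {..<jobs I})"

definition feasible_assignments :: "ra_instance \<Rightarrow> (nat \<Rightarrow> nat) set" where
  "feasible_assignments I =
     {\<alpha> \<in> {..<jobs I} \<rightarrow>\<^sub>E {..<machines I}. \<forall>j<jobs I. ptime I (\<alpha> j) j < \<infinity>}"

definition load :: "ra_instance \<Rightarrow> (nat \<Rightarrow> nat) \<Rightarrow> nat \<Rightarrow> real" where
  "load I \<alpha> i = (\<Sum>j | j < jobs I \<and> \<alpha> j = i. psize I j)"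

definition makespan :: "ra_instance \<Rightarrow> (nat \<Rightarrow> nat) \<Rightarrow> real" where
  "makespan I \<alpha> = Max (load I \<alpha> ` {..<machines I})"

definition opt_makespan :: "ra_instance \<Rightarrow> real" where
  "opt_makespan I = Min (makespan I ` feasible_assignments I)"


section \<open>A real RAM\<close>

text \<open>Job sizes are real numbers, so the machine model is the unit-cost real RAM: one sort of
  registers and arrays holds natural numbers (used for indices), another holds reals. Only index
  registers can address arrays. Each elementary instruction and each test costs one step.
  There is no multiplication of indices and no conversion from reals to indices (such as
  rounding), the operations by which unit-cost machines pack long computations into single
  steps. Registers and arrays are named by strings; a program mentions only finitely many.\<close>

record state =
  ireg :: "string \<Rightarrow> nat"
  iarr :: "string \<Rightarrow> nat \<Rightarrow> nat"
  rreg :: "string \<Rightarrow> real"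
  rarr :: "string \<Rightarrow> nat \<Rightarrow> real"

datatype instr =
    IConst string nat
  | IMove string string
  | IAdd string string string
  | ISub string string string
  | ILoad string string string
  | IStore string string string
  | RConst string nat
  | RMove string string
  | RAdd string string string
  | RSub string string string
  | RMul string string string
  | RDiv string string string
  | RLoad string string string
  | RStore string string string

text \<open>The destination comes first; in a store, it is the array followed by the index register.
  \<open>ISub\<close> is truncated subtraction.\<close>

fun step :: "instr \<Rightarrow> state \<Rightarrow> state" where
  "step (IConst x k) s = s\<lparr>ireg := (ireg s)(x := k)\<rparr>"
| "step (IMove x y) s = s\<lparr>ireg := (ireg s)(x := ireg s y)\<rparr>"
| "step (IAdd x y z) s = s\<lparr>ireg := (ireg s)(x := ireg s y + ireg s z)\<rparr>"
| "step (ISub x y z) s = s\<lparr>ireg := (ireg s)(x := ireg s y - ireg s z)\<rparr>"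
| "step (ILoad x A k) s = s\<lparr>ireg := (ireg s)(x := iarr s A (ireg s k))\<rparr>"
| "step (IStore A k x) s = s\<lparr>iarr := (iarr s)(A := (iarr s A)(ireg s k := ireg s x))\<rparr>"
| "step (RConst x k) s = s\<lparr>rreg := (rreg s)(x := real k)\<rparr>"
| "step (RMove x y) s = s\<lparr>rreg := (rreg s)(x := rreg s y)\<rparr>"
| "step (RAdd x y z) s = s\<lparr>rreg := (rreg s)(x := rreg s y + rreg s z)\<rparr>"
| "step (RSub x y z) s = s\<lparr>rreg := (rreg s)(x := rreg s y - rreg s z)\<rparr>"
| "step (RMul x y z) s = s\<lparr>rreg := (rreg s)(x := rreg s y * rreg s z)\<rparr>"
| "step (RDiv x y z) s = s\<lparr>rreg := (rreg s)(x := rreg s y / rreg s z)\<rparr>"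
| "step (RLoad x A k) s = s\<lparr>rreg := (rreg s)(x := rarr s A (ireg s k))\<rparr>"
| "step (RStore A k x) s = s\<lparr>rarr := (rarr s)(A := (rarr s A)(ireg s k := rreg s x))\<rparr>"

datatype test =
    ILess string string
  | IEq string string
  | RLess string string
  | REq string string

fun holds :: "test \<Rightarrow> state \<Rightarrow> bool" where
  "holds (ILess x y) s \<longleftrightarrow> ireg s x < ireg s y"
| "holds (IEq x y) s \<longleftrightarrow> ireg s x = ireg s y"
| "holds (RLess x y) s \<longleftrightarrow> rreg s x < rreg s y"
| "holds (REq x y) s \<longleftrightarrow> rreg s x = rreg s y"

datatype prog =
    Skip
  | Instr instr
  | Seq prog prog
  | Cond test prog prog
  | While test prog

text \<open>\<open>exec c s t s'\<close>: started in \<open>s\<close>, the program \<open>c\<close> terminates after \<open>t\<close> steps in \<open>s'\<close>.\<close>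

inductive exec :: "prog \<Rightarrow> state \<Rightarrow> nat \<Rightarrow> state \<Rightarrow> bool" where
  exec_Skip: "exec Skip s 1 s"
| exec_Instr: "exec (Instr a) s 1 (step a s)"
| exec_Seq: "exec c s t s' \<Longrightarrow> exec d s' u s'' \<Longrightarrow> exec (Seq c d) s (t + u) s''"
| exec_Cond_True: "holds b s \<Longrightarrow> exec c s t s' \<Longrightarrow> exec (Cond b c d) s (1 + t) s'"
| exec_Cond_False: "\<not> holds b s \<Longrightarrow> exec d s t s' \<Longrightarrow> exec (Cond b c d) s (1 + t) s'"
| exec_While_False: "\<not> holds b s \<Longrightarrow> exec (While b c) s 1 s"
| exec_While_True: "holds b s \<Longrightarrow> exec c s t s' \<Longrightarrow> exec (While b c) s' u s'' \<Longrightarrow>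
    exec (While b c) s (1 + t + u) s''"

inductive_cases exec_SkipE: "exec Skip s t s'"
inductive_cases exec_InstrE: "exec (Instr a) s t s'"
inductive_cases exec_SeqE: "exec (Seq c d) s t s'"
inductive_cases exec_CondE: "exec (Cond b c d) s t s'"
inductive_cases exec_WhileE: "exec (While b c) s t s'"

lemma exec_deterministic:
  "exec c s t s' \<Longrightarrow> exec c s u s'' \<Longrightarrow> u = t \<and> s'' = s'"
proof (induction arbitrary: u s'' rule: exec.induct)
  case (exec_Seq c s t s' d v s3)
  from exec_Seq.prems obtain t1 t2 r where
    r: "exec c s t1 r" "exec d r t2 s''" and u: "u = t1 + t2"
    by (rule exec_SeqE)
  have "t1 = t \<and> r = s'" using exec_Seq.IH(1) r(1) .
  then show ?case using exec_Seq.IH(2) r(2) u by blast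
next
  case (exec_While_True b s c t s' v s3)
  from exec_While_True.prems exec_While_True.hyps(1) obtain t1 t2 r where
    r: "exec c s t1 r" "exec (While b c) r t2 s''" and u: "u = 1 + t1 + t2"
    by (cases rule: exec.cases) auto
  have "t1 = t \<and> r = s'" using exec_While_True.IH(1) r(1) .
  then show ?case using exec_While_True.IH(2) r(2) u by blast
qed ((erule exec_SkipE exec_InstrE exec_CondE exec_WhileE; force)+)

text \<open>The numbers of machines and jobs are in index registers and the sizes $p_j$ in a real array.
  Since $p_{ij}$ is $p_j$ or $\infty$, the matrix $(p_{ij})$ is given by its 0/1 pattern of finite
  entries, stored row by row, with $p_{ij}$ at index \<open>i * jobs I + j\<close>. All other cells are 0.\<close>

definition input_state :: "ra_instance \<Rightarrow> state" where
  "input_state I =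
     \<lparr>ireg = (\<lambda>_. 0)(''m'' := machines I, ''n'' := jobs I),
      iarr = (\<lambda>_ _. 0)(''finite'' := (\<lambda>k.
        if k < machines I * jobs I \<and> ptime I (k div jobs I) (k mod jobs I) < \<infinity> then 1 else 0)),
      rreg = (\<lambda>_. 0),
      rarr = (\<lambda>_ _. 0)(''p'' := (\<lambda>j. if j < jobs I then psize I j else 0))\<rparr>"

definition output_assignment :: "ra_instance \<Rightarrow> state \<Rightarrow> nat \<Rightarrow> nat" where
  "output_assignment I s = restrict (iarr s ''alpha'') {..<jobs I}"

definition outputs_in_time :: "prog \<Rightarrow> ra_instance \<Rightarrow> nat \<Rightarrow> (nat \<Rightarrow> nat) \<Rightarrow> bool" where
  "outputs_in_time c I t \<alpha> \<longleftrightarrow> (\<exists>s. exec c (input_state I) t s \<and> \<alpha> = output_assignment I s)"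

end

theory Submission
  imports Defs
begin

text \<open>Process the jobs in order, each time choosing a least loaded machine among those that can run
  the job. When job \<open>j\<close> is put on a machine of load \<open>L\<close>, each of the at least \<open>h m\<close> machines that
  can run \<open>j\<close> has load at least \<open>L\<close>, so \<open>h m L\<close> is at most the total size \<open>q m p\<^sub>m\<^sub>a\<^sub>x\<close>. Hence no load
  ever exceeds \<open>(q / h) p\<^sub>m\<^sub>a\<^sub>x + p\<^sub>m\<^sub>a\<^sub>x\<close>, and \<open>p\<^sub>m\<^sub>a\<^sub>x\<close> is a lower bound for the optimum. The running
  time is even \<open>O(m n)\<close>.\<close>

section \<open>Greedy assignments and partial loads\<close>

definition partial_load :: "ra_instance \<Rightarrow> (nat \<Rightarrow> nat) \<Rightarrow> nat \<Rightarrow> nat \<Rightarrow> real" where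
  "partial_load I \<alpha> k i = (\<Sum>j | j < k \<and> \<alpha> j = i. psize I j)"

definition eligible :: "ra_instance \<Rightarrow> nat \<Rightarrow> nat set" where
  "eligible I j = {i. i < machines I \<and> ptime I i j < \<infinity>}"

text \<open>A property of assignments rather than a function, so ties may be broken in any way. It
  constrains only the values below \<open>k\<close>.\<close>

definition greedy :: "ra_instance \<Rightarrow> (nat \<Rightarrow> nat) \<Rightarrow> nat \<Rightarrow> bool" where
  "greedy I \<alpha> k \<longleftrightarrow>
     (\<forall>j<k. \<alpha> j \<in> eligible I j \<and>
        (\<forall>i\<in>eligible I j. partial_load I \<alpha> j (\<alpha> j) \<le> partial_load I \<alpha> j i))"

lemma load_eq_partial_load: "load I \<alpha> = partial_load I \<alpha> (jobs I)"
  by (simp add: fun_eq_iff load_def partial_load_def)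

lemma partial_load_0 [simp]: "partial_load I \<alpha> 0 i = 0"
  by (simp add: partial_load_def)

lemma partial_load_Suc:
  "partial_load I \<alpha> (Suc k) i = partial_load I \<alpha> k i + (if \<alpha> k = i then psize I k else 0)"
proof -
  have "{j. j < Suc k \<and> \<alpha> j = i} = (if \<alpha> k = i then insert k {j. j < k \<and> \<alpha> j = i}
      else {j. j < k \<and> \<alpha> j = i})"
    by (auto simp: less_Suc_eq)
  then show ?thesis by (simp add: partial_load_def)
qed

lemma partial_load_cong:
  "(\<And>j. j < k \<Longrightarrow> \<alpha> j = \<beta> j) \<Longrightarrow> partial_load I \<alpha> k i = partial_load I \<beta> k i"
  unfolding partial_load_def by (rule sum.cong) auto

lemma partial_load_nonneg:
  assumes "restricted_assignment I" "k \<le> jobs I"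
  shows "0 \<le> partial_load I \<alpha> k i"
  unfolding partial_load_def using assms
  by (intro sum_nonneg) (auto simp: restricted_assignment_def intro: less_imp_le)

lemma sum_partial_load:
  assumes "\<And>j. j < k \<Longrightarrow> \<alpha> j < m"
  shows "(\<Sum>i<m. partial_load I \<alpha> k i) = (\<Sum>j<k. psize I j)"
  using assms by (induction k) (simp_all add: partial_load_Suc sum.distrib)

lemma greedy_cong:
  assumes "\<And>j. j < k \<Longrightarrow> \<alpha> j = \<beta> j"
  shows "greedy I \<alpha> k \<longleftrightarrow> greedy I \<beta> k"
proof -
  have "partial_load I \<alpha> j i = partial_load I \<beta> j i" if "j < k" for i j
    using that assms by (intro partial_load_cong) auto
  then show ?thesis using assms by (simp add: greedy_def)
qed

text \<open>Partial loads at stages up to \<open>k\<close> depend only on values below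
  \<open>k\<close>, so writing position \<open>k\<close> cannot spoil the earlier choices.\<close>

lemma greedy_Suc_update:
  assumes "greedy I \<alpha> k" "b \<in> eligible I k"
    "\<And>i. i \<in> eligible I k \<Longrightarrow> partial_load I \<alpha> k b \<le> partial_load I \<alpha> k i"
  shows "greedy I (\<alpha>(k := b)) (Suc k)"
proof -
  have "greedy I (\<alpha>(k := b)) k"
    using assms(1) by (subst greedy_cong[where \<beta> = \<alpha>]) auto
  moreover have "partial_load I (\<alpha>(k := b)) k i = partial_load I \<alpha> k i" for i
    by (rule partial_load_cong) auto
  ultimately show ?thesis using assms(2,3) by (auto simp: greedy_def less_Suc_eq)
qed

section \<open>Load bound for greedy assignments\<close>

lemma psize_le_pmax: "j < jobs I \<Longrightarrow> psize I j \<le> pmax I"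
  unfolding pmax_def by (intro Max_ge) auto

text \<open>The number of machines cancels: the product on the left is the least number of eligible
  machines over all jobs.\<close>

lemma feasibility_factor_le_card_eligible:
  assumes "restricted_assignment I" "j < jobs I"
  shows "feasibility_factor I * real (machines I) \<le> real (card (eligible I j))"
proof -
  have "Min ((\<lambda>j. card (eligible I j)) ` {..<jobs I}) \<le> card (eligible I j)"
    using assms(2) by (intro Min_le) auto
  then show ?thesis
    using assms(1) by (simp add: feasibility_factor_def eligible_def restricted_assignment_def)
qed

lemma eligible_nonempty:
  assumes "restricted_assignment I" "0 < feasibility_factor I" "j < jobs I"
  shows "eligible I j \<noteq> {}"
proof -
  have "0 < feasibility_factor I * real (machines I)"
    using assms by (simp add: restricted_assignment_def)
  then show ?thesis using feasibility_factor_le_card_eligible[OF assms(1,3)] by force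
qed

text \<open>The chosen machine has minimal load among the eligible ones, so their number times its
  load is at most their total load, hence at most the total size of all jobs.\<close>

lemma greedy_load_before:
  assumes I: "restricted_assignment I" and "greedy I \<alpha> (Suc k)" and k: "k < jobs I"
  shows "feasibility_factor I * real (machines I) * partial_load I \<alpha> k (\<alpha> k)
    \<le> (\<Sum>j<jobs I. psize I j)"
proof -
  let ?L = "partial_load I \<alpha> k"
  have "feasibility_factor I * real (machines I) * ?L (\<alpha> k) \<le> real (card (eligible I k)) * ?L (\<alpha> k)"
    using feasibility_factor_le_card_eligible[OF I k] partial_load_nonneg[OF I] k
    by (intro mult_right_mono) auto
  also have "\<dots> = (\<Sum>i\<in>eligible I k. ?L (\<alpha> k))" by simp
  also have "\<dots> \<le> (\<Sum>i\<in>eligible I k. ?L i)"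
    using assms(2) by (intro sum_mono) (auto simp: greedy_def)
  also have "\<dots> \<le> (\<Sum>i<machines I. ?L i)"
    using partial_load_nonneg[OF I] k by (intro sum_mono2) (auto simp: eligible_def)
  also have "\<dots> = (\<Sum>j<k. psize I j)"
    using assms(2) by (intro sum_partial_load) (auto simp: greedy_def eligible_def)
  also have "\<dots> \<le> (\<Sum>j<jobs I. psize I j)"
    using I k by (intro sum_mono2) (auto simp: restricted_assignment_def intro: less_imp_le)
  finally show ?thesis .
qed

text \<open>Induction over the jobs: only the machine that receives job \<open>k\<close> changes.
  Its load was at most \<open>q / feasibility_factor I * pmax I\<close> and grows by at most
  \<open>pmax I\<close>.\<close>

lemma greedy_partial_load_le:
  assumes I: "restricted_assignment I" and h: "0 < feasibility_factor I" and q: "0 < q"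
    and total: "(\<Sum>j<jobs I. psize I j) = real (machines I) * (q * pmax I)"
    and "greedy I \<alpha> k" "k \<le> jobs I"
  shows "partial_load I \<alpha> k i \<le> (1 + q / feasibility_factor I) * pmax I"
  using assms(5,6)
proof (induction k)
  case 0
  \<comment> \<open>The bound must be nonnegative to cover the empty load; job 0 exists and has
    positive size.\<close>
  have "0 < jobs I" and "0 < psize I 0" using I by (auto simp: restricted_assignment_def)
  then have "0 < pmax I" using psize_le_pmax[of 0 I] by simp
  then show ?case using h q by simp
next
  case (Suc k)
  have k: "k < jobs I" and g: "greedy I \<alpha> k" using Suc.prems by (auto simp: greedy_def)
  have m: "0 < real (machines I)" using I by (simp add: restricted_assignment_def)
  have "real (machines I) * (feasibility_factor I * partial_load I \<alpha> k (\<alpha> k))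
      \<le> real (machines I) * (q * pmax I)"
    using greedy_load_before[OF I Suc.prems(1) k] total by (simp add: mult_ac)
  then have "feasibility_factor I * partial_load I \<alpha> k (\<alpha> k) \<le> q * pmax I"
    using m by simp
  then have "partial_load I \<alpha> k (\<alpha> k) \<le> q / feasibility_factor I * pmax I"
    using h by (simp add: field_simps)
  then show ?case
    using Suc.IH[OF g] k psize_le_pmax[OF k] by (auto simp: partial_load_Suc algebra_simps)
qed

section \<open>Comparison with the optimum\<close>

lemma finite_feasible_assignments: "finite (feasible_assignments I)"
  unfolding feasible_assignments_def by (intro finite_Collect_conjI disjI1) (auto intro: finite_PiE)

text \<open>A job of maximal size alone contributes \<open>pmax I\<close> to the load of its
  machine.\<close>

lemma pmax_le_makespan:
  assumes I: "restricted_assignment I" and \<alpha>: "\<alpha> \<in> feasible_assignments I"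
  shows "pmax I \<le> makespan I \<alpha>"
proof -
  have "pmax I \<in> psize I ` {..<jobs I}"
    unfolding pmax_def using I by (intro Max_in) (auto simp: restricted_assignment_def lessThan_empty_iff)
  then obtain j where j: "j < jobs I" "pmax I = psize I j" by auto
  have "pmax I \<le> load I \<alpha> (\<alpha> j)"
    unfolding load_def j(2) using I j(1)
    by (intro member_le_sum) (auto simp: restricted_assignment_def intro: less_imp_le)
  also have "\<dots> \<le> makespan I \<alpha>"
    unfolding makespan_def using \<alpha> j(1) by (intro Max_ge) (auto simp: feasible_assignments_def)
  finally show ?thesis .
qed

lemma greedy_approximation:
  assumes I: "restricted_assignment I" and h: "0 < feasibility_factor I" and q: "0 < q"
    and total: "(\<Sum>j<jobs I. psize I j) = real (machines I) * (q * pmax I)"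
    and "greedy I \<alpha> (jobs I)"
  defines "\<beta> \<equiv> restrict \<alpha> {..<jobs I}"
  shows "\<beta> \<in> feasible_assignments I"
    and "makespan I \<beta> \<le> (1 + q / feasibility_factor I) * opt_makespan I"
proof -
  have g: "greedy I \<beta> (jobs I)"
    using assms(5) by (subst greedy_cong[where \<beta> = \<alpha>]) (auto simp: \<beta>_def)
  show feas: "\<beta> \<in> feasible_assignments I"
    using g unfolding feasible_assignments_def greedy_def eligible_def by (auto simp: \<beta>_def)
  \<comment> \<open>The minimum is attained because \<open>\<beta>\<close> itself shows that the
    finite set of feasible assignments is nonempty.\<close>
  have "opt_makespan I \<in> makespan I ` feasible_assignments I"
    unfolding opt_makespan_def using feas finite_feasible_assignments by (intro Min_in) auto
  then have "pmax I \<le> opt_makespan I" using pmax_le_makespan[OF I] by auto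
  then have "(1 + q / feasibility_factor I) * pmax I
      \<le> (1 + q / feasibility_factor I) * opt_makespan I"
    using h q by (intro mult_left_mono) auto
  moreover have "makespan I \<beta> \<le> (1 + q / feasibility_factor I) * pmax I"
    unfolding makespan_def
    using I greedy_partial_load_le[OF I h q total g order_refl]
    by (subst Max_le_iff) (auto simp: load_eq_partial_load restricted_assignment_def lessThan_empty_iff)
  ultimately show "makespan I \<beta> \<le> (1 + q / feasibility_factor I) * opt_makespan I" by simp
qed


section \<open>Termination with time bounds\<close>

definition terminates :: "prog \<Rightarrow> state \<Rightarrow> nat \<Rightarrow> (state \<Rightarrow> bool) \<Rightarrow> bool" where
  "terminates c s T Q \<longleftrightarrow> (\<exists>t s'. exec c s t s' \<and> t \<le> T \<and> Q s')"

text \<open>Nesting the run of \<open>d\<close> in the postcondition of \<open>c\<close> avoids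
  naming an intermediate assertion.\<close>

lemma terminates_Seq:
  "terminates c s T (\<lambda>s'. terminates d s' U Q) \<Longrightarrow> terminates (Seq c d) s (T + U) Q"
  unfolding terminates_def by (meson add_mono exec_Seq)

lemma terminates_mono:
  "terminates c s T Q \<Longrightarrow> T \<le> U \<Longrightarrow> (\<And>s'. Q s' \<Longrightarrow> R s') \<Longrightarrow> terminates c s U R"
  unfolding terminates_def by (meson order_trans)

text \<open>Rule for a counted loop: each of the \<open>N - k\<close> rounds costs one test and at
  most \<open>B\<close> steps, and the outer \<open>Suc\<close> pays for the final failing
  test.\<close>

lemma terminates_While:
  assumes init: "P k s" and "k \<le> N"
    and body: "\<And>k s. k < N \<Longrightarrow> P k s \<Longrightarrow> holds b s \<and> terminates c s B (P (Suc k))"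
    and exit: "\<And>s. P N s \<Longrightarrow> \<not> holds b s"
  shows "terminates (While b c) s (Suc (Suc B * (N - k))) (P N)"
  using \<open>k \<le> N\<close> init
proof (induction k arbitrary: s rule: inc_induct)
  case base
  then show ?case unfolding terminates_def using exec_While_False exit by fastforce
next
  case (step k)
  from body[OF step.hyps(2) step.prems] obtain t s' where
    s': "holds b s" "exec c s t s'" "t \<le> B" "P (Suc k) s'"
    by (auto simp: terminates_def)
  from step.IH[OF s'(4)] obtain u s'' where
    s'': "exec (While b c) s' u s''" "u \<le> Suc (Suc B * (N - Suc k))" "P N s''"
    by (auto simp: terminates_def)
  have "N - k = Suc (N - Suc k)" using step.hyps by simp
  then have "1 + t + u \<le> Suc (Suc B * (N - k))" using s'(3) s''(2) by simp
  then show ?case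
    unfolding terminates_def using exec_While_True[OF s'(1,2) s''(1)] s''(3) by blast
qed


fun loop_free :: "prog \<Rightarrow> bool" where
  "loop_free (Seq c d) \<longleftrightarrow> loop_free c \<and> loop_free d"
| "loop_free (Cond b c d) \<longleftrightarrow> loop_free c \<and> loop_free d"
| "loop_free (While b c) \<longleftrightarrow> False"
| "loop_free _ \<longleftrightarrow> True"

text \<open>An executable semantics, so that simplification computes final states. The default
  equation is right for \<open>Skip\<close>; loops are excluded by \<open>loop_free\<close> wherever
  \<open>run\<close> is related to \<open>exec\<close>.\<close>

fun run :: "prog \<Rightarrow> state \<Rightarrow> state" where
  "run (Instr a) s = step a s"
| "run (Seq c d) s = run d (run c s)"
| "run (Cond b c d) s = (if holds b s then run c s else run d s)"
| "run _ s = s"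

fun max_cost :: "prog \<Rightarrow> nat" where
  "max_cost (Seq c d) = max_cost c + max_cost d"
| "max_cost (Cond b c d) = 1 + max (max_cost c) (max_cost d)"
| "max_cost _ = 1"

lemma exec_loop_free:
  "loop_free c \<Longrightarrow> \<exists>t \<le> max_cost c. exec c s t (run c s)"
proof (induction c arbitrary: s)
  case Skip
  then show ?case using exec_Skip by auto
next
  case (Instr a)
  then show ?case using exec_Instr by auto
next
  case (Seq c d)
  then obtain t u where "t \<le> max_cost c" "exec c s t (run c s)"
    "u \<le> max_cost d" "exec d (run c s) u (run d (run c s))"
    by force
  then show ?case using exec_Seq by (auto intro!: exI[of _ "t + u"])
next
  case (Cond b c d)
  then obtain t u where tu: "t \<le> max_cost c" "exec c s t (run c s)"
    "u \<le> max_cost d" "exec d s u (run d s)"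
    by force
  show ?case
  proof (cases "holds b s")
    case True
    then show ?thesis using exec_Cond_True[OF True tu(2)] tu(1) by (auto intro!: exI[of _ "1 + t"])
  next
    case False
    then show ?thesis using exec_Cond_False[OF False tu(4)] tu(3) by (auto intro!: exI[of _ "1 + u"])
  qed
qed simp

lemma terminates_loop_free:
  "loop_free c \<Longrightarrow> max_cost c \<le> T \<Longrightarrow> Q (run c s) \<Longrightarrow> terminates c s T Q"
  unfolding terminates_def using exec_loop_free by (meson order_trans)


section \<open>The greedy program\<close>

fun block :: "instr list \<Rightarrow> prog \<Rightarrow> prog" where
  "block [] c = c"
| "block (a # as) c = Seq (Instr a) (block as c)"

text \<open>Register \<open>k\<close> holds the index \<open>i * jobs I + j\<close>, updated by addition since indices cannot be
  multiplied. The value \<open>best = m\<close> encodes that no eligible machine has been found yet.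
  Register \<open>zero\<close> is never written and keeps its initial value.\<close>

definition update_best :: prog where
  "update_best = block [IMove ''best'' ''i''] (Instr (RMove ''bestload'' ''l''))"

definition scan_body :: prog where
  "scan_body =
     Seq
       (block [ILoad ''f'' ''finite'' ''k'', RLoad ''l'' ''L'' ''i'']
         (Cond (ILess ''zero'' ''f'')
           (Cond (IEq ''best'' ''m'') update_best
             (Cond (RLess ''l'' ''bestload'') update_best Skip))
           Skip))
       (block [IAdd ''k'' ''k'' ''n''] (Instr (IAdd ''i'' ''i'' ''one'')))"

definition scan :: prog where
  "scan = While (ILess ''i'' ''m'') scan_body"

text \<open>\<open>k\<close> starts at \<open>j\<close>, the matrix index for machine 0. An old
  value of \<open>bestload\<close> may remain, since the scan overwrites it before comparing as long
  as \<open>best\<close> equals \<open>m\<close>.\<close>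

definition assign_head :: prog where
  "assign_head = block [IMove ''best'' ''m'', IMove ''k'' ''j''] (Instr (IConst ''i'' 0))"

text \<open>After a scan that found a machine, \<open>bestload\<close> is the load of
  \<open>best\<close>, so adding the job size gives the new load to be stored.\<close>

definition assign_tail :: prog where
  "assign_tail =
     block [IStore ''alpha'' ''j'' ''best'', RLoad ''pj'' ''p'' ''j'',
         RAdd ''bestload'' ''bestload'' ''pj'', RStore ''L'' ''best'' ''bestload'']
       (Instr (IAdd ''j'' ''j'' ''one''))"

definition assign_body :: prog where
  "assign_body = Seq assign_head (Seq scan assign_tail)"

definition greedy_prog :: prog where
  "greedy_prog =
     Seq (block [IConst ''one'' 1] (Instr (IConst ''j'' 0)))
       (While (ILess ''j'' ''n'') assign_body)"

section \<open>Invariants, correctness and running time\<close>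

definition assign_inv :: "ra_instance \<Rightarrow> nat \<Rightarrow> state \<Rightarrow> bool" where
  "assign_inv I j s \<longleftrightarrow>
     ireg s ''m'' = machines I \<and> ireg s ''n'' = jobs I \<and> ireg s ''j'' = j \<and>
     ireg s ''one'' = 1 \<and> ireg s ''zero'' = 0 \<and>
     iarr s ''finite'' = iarr (input_state I) ''finite'' \<and>
     rarr s ''p'' = rarr (input_state I) ''p'' \<and>
     greedy I (iarr s ''alpha'') j \<and>
     rarr s ''L'' = partial_load I (iarr s ''alpha'') j"

text \<open>The value \<open>machines I\<close> is never eligible, so the two cases cannot be
  confused. At \<open>i = machines I\<close> the second case makes \<open>best\<close> a least
  loaded eligible machine.\<close>

definition scan_inv :: "ra_instance \<Rightarrow> nat \<Rightarrow> nat \<Rightarrow> state \<Rightarrow> bool" where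
  "scan_inv I j i s \<longleftrightarrow>
     assign_inv I j s \<and> ireg s ''i'' = i \<and> ireg s ''k'' = i * jobs I + j \<and>
     (if ireg s ''best'' = machines I then \<forall>i'<i. i' \<notin> eligible I j
      else ireg s ''best'' \<in> eligible I j \<and>
        rreg s ''bestload'' = rarr s ''L'' (ireg s ''best'') \<and>
        (\<forall>i'<i. i' \<in> eligible I j \<longrightarrow> rreg s ''bestload'' \<le> rarr s ''L'' i'))"

lemma input_finite:
  assumes "i < machines I" "j < jobs I"
  shows "0 < iarr (input_state I) ''finite'' (i * jobs I + j) \<longleftrightarrow> i \<in> eligible I j"
proof -
  \<comment> \<open>The index passes the range guard in \<open>input_state\<close>; division with
    remainder by \<open>jobs I\<close> then recovers \<open>i\<close> and \<open>j\<close>.\<close>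
  have "i * jobs I + j < Suc i * jobs I" using assms(2) by simp
  also have "\<dots> \<le> machines I * jobs I" using assms(1) by (intro mult_le_mono1) simp
  finally show ?thesis using assms by (simp add: input_state_def eligible_def)
qed

text \<open>The bound 9 consists of 2 loads, at most 3 tests and 2 moves, and 2 additions.\<close>

lemma scan_body_correct:
  assumes inv: "scan_inv I j i s" and i: "i < machines I" and j: "j < jobs I"
  shows "terminates scan_body s 9 (scan_inv I j (Suc i))"
proof (rule terminates_loop_free)
  have f: "0 < iarr s ''finite'' (i * jobs I + j) \<longleftrightarrow> i \<in> eligible I j"
    using inv input_finite[OF i j] by (simp add: scan_inv_def assign_inv_def)
  \<comment> \<open>Transitivity handles a new best machine: its load is below
    \<open>bestload\<close>, which is at most every eligible load seen before.\<close>
  show "scan_inv I j (Suc i) (run scan_body s)"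
    using inv i f unfolding scan_body_def update_best_def scan_inv_def assign_inv_def
    by (auto simp: less_Suc_eq) (meson less_imp_le less_le_trans)
qed (simp_all add: scan_body_def update_best_def)

lemma scan_correct:
  assumes inv: "scan_inv I j 0 s" and j: "j < jobs I"
  shows "terminates scan s (Suc (10 * machines I)) (scan_inv I j (machines I))"
proof -
  have "terminates scan s (Suc (Suc 9 * (machines I - 0))) (scan_inv I j (machines I))"
    unfolding scan_def
  proof (rule terminates_While[where P = "scan_inv I j"])
    fix i s assume i: "i < machines I" and inv: "scan_inv I j i s"
    have "holds (ILess ''i'' ''m'') s" using i inv by (simp add: scan_inv_def assign_inv_def)
    then show "holds (ILess ''i'' ''m'') s \<and> terminates scan_body s 9 (scan_inv I j (Suc i))"
      using scan_body_correct[OF inv i j] by simp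
  qed (use inv in \<open>simp_all add: scan_inv_def assign_inv_def\<close>)
  then show ?thesis by simp
qed

lemma assign_inv_Suc:
  assumes inv: "scan_inv I j (machines I) s" and ne: "eligible I j \<noteq> {}" and j: "j < jobs I"
  shows "assign_inv I (Suc j) (run assign_tail s)"
proof -
  let ?\<alpha> = "iarr s ''alpha''" and ?b = "ireg s ''best''"
  \<comment> \<open>After a full scan, the initial value of \<open>best\<close> would mean that no
    machine is eligible.\<close>
  have "?b \<noteq> machines I"
    using inv ne by (auto simp: scan_inv_def eligible_def split: if_splits)
  with inv have b: "?b \<in> eligible I j" "rreg s ''bestload'' = partial_load I ?\<alpha> j ?b"
    "\<And>i. i \<in> eligible I j \<Longrightarrow> partial_load I ?\<alpha> j ?b \<le> partial_load I ?\<alpha> j i"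
    by (auto simp: scan_inv_def assign_inv_def eligible_def)
  have "greedy I (?\<alpha>(j := ?b)) (Suc j)"
    using inv b by (intro greedy_Suc_update) (auto simp: scan_inv_def assign_inv_def)
  \<comment> \<open>Writing position \<open>j\<close> leaves the loads before job \<open>j\<close>
    unchanged, so only the chosen machine gains.\<close>
  moreover have "partial_load I (?\<alpha>(j := ?b)) (Suc j) =
      (partial_load I ?\<alpha> j)(?b := partial_load I ?\<alpha> j ?b + psize I j)"
    using partial_load_cong[of j "?\<alpha>(j := ?b)" ?\<alpha> I] by (auto simp: partial_load_Suc)
  moreover have "rarr (input_state I) ''p'' j = psize I j" using j by (simp add: input_state_def)
  ultimately show ?thesis
    using inv b(2) by (simp add: assign_tail_def scan_inv_def assign_inv_def)
qed

lemma assign_body_correct: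
  assumes inv: "assign_inv I j s" and ne: "eligible I j \<noteq> {}" and j: "j < jobs I"
  shows "terminates assign_body s (9 + 10 * machines I) (assign_inv I (Suc j))"
proof -
  have init: "scan_inv I j 0 (run assign_head s)"
    using inv by (simp add: assign_head_def scan_inv_def assign_inv_def)
  have tail: "terminates assign_tail s' 5 (assign_inv I (Suc j))"
    if "scan_inv I j (machines I) s'" for s'
    using assign_inv_Suc[OF that ne j]
    by (rule terminates_loop_free[rotated 2]) (simp_all add: assign_tail_def)
  have "terminates scan (run assign_head s) (Suc (10 * machines I))
      (\<lambda>s'. terminates assign_tail s' 5 (assign_inv I (Suc j)))"
    using terminates_mono[OF scan_correct[OF init j] order_refl tail] .
  then have "terminates assign_body s (3 + (Suc (10 * machines I) + 5)) (assign_inv I (Suc j))"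
    unfolding assign_body_def
    by (intro terminates_Seq terminates_loop_free[of assign_head]) (simp_all add: assign_head_def)
  then show ?thesis by simp
qed

text \<open>The 3 counts two initializations and the last loop test; each round adds one test to the
  cost of \<open>assign_body\<close>. Positivity of the feasibility factor gives every job an
  eligible machine.\<close>

lemma greedy_prog_correct:
  assumes I: "restricted_assignment I" and h: "0 < feasibility_factor I"
  shows "terminates greedy_prog (input_state I) (3 + (10 + 10 * machines I) * jobs I)
    (assign_inv I (jobs I))"
proof -
  let ?init = "block [IConst ''one'' 1] (Instr (IConst ''j'' 0))"
  have "assign_inv I 0 (run ?init (input_state I))"
    by (simp add: assign_inv_def input_state_def greedy_def fun_eq_iff)
  then have "terminates (While (ILess ''j'' ''n'') assign_body) (run ?init (input_state I))
      (Suc (Suc (9 + 10 * machines I) * (jobs I - 0))) (assign_inv I (jobs I))"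
    using assign_body_correct eligible_nonempty[OF I h]
    by (intro terminates_While[where P = "assign_inv I"]) (auto simp: assign_inv_def)
  then have "terminates greedy_prog (input_state I)
      (2 + Suc (Suc (9 + 10 * machines I) * (jobs I - 0))) (assign_inv I (jobs I))"
    unfolding greedy_prog_def
    by (intro terminates_Seq terminates_loop_free[of ?init]) simp_all
  then show ?thesis by (simp add: eval_nat_numeral)
qed

theorem theorem5:
  "\<exists>(c :: prog) (K :: real). \<forall>(I :: ra_instance) (h :: real) (q :: real).
     restricted_assignment I \<longrightarrow>
     h = feasibility_factor I \<longrightarrow> 0 < h \<longrightarrow> h \<le> 1 \<longrightarrow>
     0 < q \<longrightarrow> q < h \<longrightarrow>
     1 / real (machines I) * (\<Sum>j<jobs I. psize I j) = q * pmax I \<longrightarrow>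
     (\<exists>t \<alpha>. outputs_in_time c I t \<alpha> \<and>
        \<alpha> \<in> feasible_assignments I \<and>
        makespan I \<alpha> \<le> (1 + q / h) * opt_makespan I \<and>
        real t \<le> K * (real (machines I) ^ 2 * real (jobs I)))"
proof (rule exI[of _ greedy_prog], rule exI[of _ 23], intro allI impI)
  fix I h q
  assume I: "restricted_assignment I" and h: "h = feasibility_factor I" "0 < h" and q: "0 < q"
    and avg: "1 / real (machines I) * (\<Sum>j<jobs I. psize I j) = q * pmax I"
  have mn: "1 \<le> machines I" "1 \<le> jobs I" using I by (auto simp: restricted_assignment_def)
  from greedy_prog_correct[OF I] h obtain t s where
    s: "exec greedy_prog (input_state I) t s" "assign_inv I (jobs I) s"
    and t: "t \<le> 3 + (10 + 10 * machines I) * jobs I"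
    by (auto simp: terminates_def)
  have total: "(\<Sum>j<jobs I. psize I j) = real (machines I) * (q * pmax I)"
    using avg mn by (simp add: field_simps)
  have g: "greedy I (iarr s ''alpha'') (jobs I)" using s(2) by (simp add: assign_inv_def)
  \<comment> \<open>All three terms of the time bound are compared with the same product, which
    gives the constant 3 + 10 + 10 = 23.\<close>
  have "jobs I \<le> machines I ^ 2 * jobs I" "1 \<le> machines I ^ 2 * jobs I"
    "machines I * jobs I \<le> machines I ^ 2 * jobs I"
    using mn by (auto simp: power2_eq_square Suc_le_eq)
  moreover have "t \<le> 3 + 10 * jobs I + 10 * (machines I * jobs I)"
    using t by (simp add: algebra_simps)
  ultimately have "t \<le> 23 * (machines I ^ 2 * jobs I)" by linarith
  then have "real t \<le> real (23 * (machines I ^ 2 * jobs I))" by (rule of_nat_mono)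
  then have "real t \<le> 23 * (real (machines I) ^ 2 * real (jobs I))" by simp
  then show "\<exists>t \<alpha>. outputs_in_time greedy_prog I t \<alpha> \<and> \<alpha> \<in> feasible_assignments I \<and>
      makespan I \<alpha> \<le> (1 + q / h) * opt_makespan I \<and>
      real t \<le> 23 * (real (machines I) ^ 2 * real (jobs I))"
    using greedy_approximation[OF I _ q total g] h s(1)
    by (auto simp: outputs_in_time_def output_assignment_def)
qed

end
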